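(* Let $N:A\to A$ be a Nijenhuis operator on a compatible associative algebra $A=(A,\mu_1,\mu_2)$. Then $N$ induces a trivial linear deformation of $A$ generated by $(\omega_1,\omega_2)$, where $$\omega_i(a,b):=a\cdot_iN(b)+N(a)\cdot_ib-N(a\cdot_ib),\quad\text{for } i=1,2 \text{ and } a,b\in A.$$
   Context: All vector spaces are finite-dimensional over a field $\mathbb{K}$ of characteristic $0$. A compatible associative algebra is a triple $(A,\mu_1,\mu_2)$ of a vector space with two associative bilinear products, written $a\cdot_1 b$ and $a\cdot_2 b$, with $(a\cdot_1 b)\cdot_2 c+(a\cdot_2 b)\cdot_1 c=a\cdot_1(b\cdot_2 c)+a\cdot_2(b\cdot_1 c)$ for all $a,b,c$. Morphisms are linear maps preserving both products. A Nijenhuis operator on $(A,\mu_1,\mu_2)$ is a linear map $N:A\to A$ with $N(a)\cdot_iN(b)=N\big(a\cdot_iN(b)+N(a)\cdot_ib-N(a\cdot_ib)\big)$ for $i=1,2$ and all $a,b\in A$. A pair $(\omega_1,\omega_2)$ of bilinear maps $A\otimes A\to A$ generates a linear deformation of $A$ if $(A,\mu_1^t=\mu_1+t\omega_1,\mu_2^t=\mu_2+t\omega_2)$ is a compatible associative algebra for all values of $t$. Linear deformations generated by $(\omega_1,\omega_2)$ and $(\omega_1',\omega_2')$ are equivalent if there is a linear map $N:A\to A$ such that (for all $t$) $\mathrm{id}+tN:(A,\mu_1+t\omega_1,\mu_2+t\omega_2)\to(A,\mu_1+t\omega_1',\mu_2+t\omega_2')$ is a morphism of compatible associative algebras. A linear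 deformation generated by $(\omega_1,\omega_2)$ is trivial if it is equivalent to the undeformed one, generated by $(\omega_1',\omega_2')=(0,0)$. *)

theory Defs
  imports Complex_Main
begin

definition bilinear_map ::
    "('k::field \<Rightarrow> 'a::ab_group_add \<Rightarrow> 'a) \<Rightarrow> ('a \<Rightarrow> 'a \<Rightarrow> 'a) \<Rightarrow> bool" where
  "bilinear_map scale m \<longleftrightarrow>
     (\<forall>a. Vector_Spaces.linear scale scale (\<lambda>b. m a b)) \<and>
     (\<forall>b. Vector_Spaces.linear scale scale (\<lambda>a. m a b))"

text \<open>The underlying space is the whole type \<open>'a\<close> with the scalar action \<open>scale\<close>.\<close>

locale compatible_associative_algebra = vector_space scale
  for scale :: "'k::field_char_0 \<Rightarrow> 'a::ab_group_add \<Rightarrow> 'a" +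
  fixes mu1 mu2 :: "'a \<Rightarrow> 'a \<Rightarrow> 'a"
  assumes finite_dimensional: "\<exists>B. finite B \<and> span B = UNIV"
    and bilinear1: "bilinear_map scale mu1"
    and bilinear2: "bilinear_map scale mu2"
    and assoc1: "mu1 (mu1 a b) c = mu1 a (mu1 b c)"
    and assoc2: "mu2 (mu2 a b) c = mu2 a (mu2 b c)"
    and compatible: "mu2 (mu1 a b) c + mu1 (mu2 a b) c = mu1 a (mu2 b c) + mu2 a (mu1 b c)"

locale compatible_associative_algebra_morphism =
  source: compatible_associative_algebra scale mu1 mu2 +
  target: compatible_associative_algebra scale' mu1' mu2'
  for scale :: "'k::field_char_0 \<Rightarrow> 'a::ab_group_add \<Rightarrow> 'a"
    and mu1 mu2 :: "'a \<Rightarrow> 'a \<Rightarrow> 'a"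
    and scale' :: "'k \<Rightarrow> 'b::ab_group_add \<Rightarrow> 'b"
    and mu1' mu2' :: "'b \<Rightarrow> 'b \<Rightarrow> 'b" +
  fixes f :: "'a \<Rightarrow> 'b"
  assumes linear: "Vector_Spaces.linear scale scale' f"
    and preserves1: "f (mu1 a b) = mu1' (f a) (f b)"
    and preserves2: "f (mu2 a b) = mu2' (f a) (f b)"

context compatible_associative_algebra
begin

definition nijenhuis_operator :: "('a \<Rightarrow> 'a) \<Rightarrow> bool" where
  "nijenhuis_operator N \<longleftrightarrow>
     Vector_Spaces.linear scale scale N \<and>
     (\<forall>a b. mu1 (N a) (N b) = N (mu1 a (N b) + mu1 (N a) b - N (mu1 a b))) \<and>
     (\<forall>a b. mu2 (N a) (N b) = N (mu2 a (N b) + mu2 (N a) b - N (mu2 a b)))"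

definition deform :: "'k \<Rightarrow> ('a \<Rightarrow> 'a \<Rightarrow> 'a) \<Rightarrow> ('a \<Rightarrow> 'a \<Rightarrow> 'a) \<Rightarrow> 'a \<Rightarrow> 'a \<Rightarrow> 'a" where
  "deform t mu w = (\<lambda>a b. mu a b + scale t (w a b))"

definition generates_linear_deformation ::
    "('a \<Rightarrow> 'a \<Rightarrow> 'a) \<Rightarrow> ('a \<Rightarrow> 'a \<Rightarrow> 'a) \<Rightarrow> bool" where
  "generates_linear_deformation w1 w2 \<longleftrightarrow>
     bilinear_map scale w1 \<and> bilinear_map scale w2 \<and>
     (\<forall>t. compatible_associative_algebra scale (deform t mu1 w1) (deform t mu2 w2))"

definition equivalent_linear_deformations ::
    "('a \<Rightarrow> 'a \<Rightarrow> 'a) \<Rightarrow> ('a \<Rightarrow> 'a \<Rightarrow> 'a) \<Rightarrow> ('a \<Rightarrow> 'a \<Rightarrow> 'a) \<Rightarrow> ('a \<Rightarrow> 'a \<Rightarrow> 'a) \<Rightarrow> bool" where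
  "equivalent_linear_deformations w1 w2 w1' w2' \<longleftrightarrow>
     generates_linear_deformation w1 w2 \<and>
     generates_linear_deformation w1' w2' \<and>
     (\<exists>N. Vector_Spaces.linear scale scale N \<and>
       (\<forall>t. compatible_associative_algebra_morphism
              scale (deform t mu1 w1) (deform t mu2 w2)
              scale (deform t mu1 w1') (deform t mu2 w2')
              (\<lambda>a. a + scale t (N a))))"

definition trivial_linear_deformation ::
    "('a \<Rightarrow> 'a \<Rightarrow> 'a) \<Rightarrow> ('a \<Rightarrow> 'a \<Rightarrow> 'a) \<Rightarrow> bool" where
  "trivial_linear_deformation w1 w2 \<longleftrightarrow>
     equivalent_linear_deformations w1 w2 (\<lambda>a b. 0) (\<lambda>a b. 0)"

end

end

theory Submission
  imports Defs
begin

text \<open>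
  Write \<open>\<omega>\<close> for the product that \<open>N\<close> induces from a product \<open>\<mu>\<close>. The Nijenhuis condition reads
  \<open>N (\<omega> a b) = \<mu> (N a) (N b)\<close>. This is the coefficient of \<open>t\<^sup>2\<close> in the identity which says that
  \<open>id + t N\<close> is multiplicative from \<open>\<mu> + t \<omega>\<close> to \<open>\<mu>\<close>; the coefficient of \<open>t\<close> is the definition of
  \<open>\<omega>\<close>. So \<open>id + t N\<close> trivialises the deformation, as soon as the deformed products satisfy the axioms.

  Where \<open>id + t N\<close> is invertible the axioms are transported from \<open>\<mu>\<close>, and the transport can be
  written polynomially in \<open>t\<close>, which gives a formula that holds for every \<open>t\<close>. A double
  product \<open>f a b c\<close>, bracketed in either way and formed from two products that may differ, turns under
  deformation of both products into \<open>f + t D f + t\<^sup>2 E f\<close>, where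
  \<open>D f a b c = f (N a) b c + f a (N b) c + f a b (N c) - N (f a b c)\<close> and
  \<open>E f a b c = f (N a) (N b) c + f (N a) b (N c) + f a (N b) (N c) - N (D f a b c)\<close>
  (lemmas \<open>deformed_left_product\<close> and \<open>deformed_right_product\<close>).
  This expression is additive in \<open>f\<close> and does not depend on the bracketing. Associativity and
  compatibility are equations between sums of double products, so both pass to the deformation.
\<close>

lemma bilinear_mapD:
  assumes "bilinear_map scale m"
  shows "m (a + b) c = m a c + m b c" "m a (b + c) = m a b + m a c"
    "m (a - b) c = m a c - m b c" "m a (b - c) = m a b - m a c"
    "m (scale t a) b = scale t (m a b)" "m a (scale t b) = scale t (m a b)"
proof -
  interpret l: Vector_Spaces.linear scale scale "\<lambda>a. m a c" for c
    using assms by (simp add: bilinear_map_def)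
  interpret r: Vector_Spaces.linear scale scale "\<lambda>b. m a b" for a
    using assms by (simp add: bilinear_map_def)
  show "m (a + b) c = m a c + m b c" "m (a - b) c = m a c - m b c"
      "m (scale t a) b = scale t (m a b)"
    by (rule l.add l.diff l.scale)+
  show "m a (b + c) = m a b + m a c" "m a (b - c) = m a b - m a c"
      "m a (scale t b) = scale t (m a b)"
    by (rule r.add r.diff r.scale)+
qed

lemma (in vector_space) bilinear_mapI:
  assumes "\<And>a b c. m (a + b) c = m a c + m b c" "\<And>a b c. m a (b + c) = m a b + m a c"
    "\<And>t a b. m (scale t a) b = scale t (m a b)" "\<And>t a b. m a (scale t b) = scale t (m a b)"
  shows "bilinear_map scale m"
  unfolding bilinear_map_def
  by (auto intro!: Vector_Spaces.linear.intro module_hom.intro module_hom_axioms.intro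
      vector_space_axioms module_axioms assms)

locale linear_endomorphism = vector_space scale
  for scale :: "'k::field \<Rightarrow> 'a::ab_group_add \<Rightarrow> 'a" +
  fixes N :: "'a \<Rightarrow> 'a"
  assumes linear_N: "Vector_Spaces.linear scale scale N"
begin

lemma N_add: "N (a + b) = N a + N b"
  and N_scale: "N (scale t a) = scale t (N a)"
proof -
  interpret l: Vector_Spaces.linear scale scale N by (rule linear_N)
  show "N (a + b) = N a + N b" "N (scale t a) = scale t (N a)"
    by (rule l.add l.scale)+
qed

definition induced :: "('a \<Rightarrow> 'a \<Rightarrow> 'a) \<Rightarrow> 'a \<Rightarrow> 'a \<Rightarrow> 'a" where
  "induced m a b = m a (N b) + m (N a) b - N (m a b)"

definition deformed :: "'k \<Rightarrow> ('a \<Rightarrow> 'a \<Rightarrow> 'a) \<Rightarrow> 'a \<Rightarrow> 'a \<Rightarrow> 'a" where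
  "deformed t m a b = m a b + scale t (induced m a b)"

definition nijenhuis :: "('a \<Rightarrow> 'a \<Rightarrow> 'a) \<Rightarrow> bool" where
  "nijenhuis m \<longleftrightarrow> (\<forall>a b. m (N a) (N b) = N (induced m a b))"

lemma bilinear_induced:
  assumes "bilinear_map scale m"
  shows "bilinear_map scale (induced m)"
  by (rule bilinear_mapI)
    (simp_all add: induced_def bilinear_mapD[OF assms] N_add N_scale scale_left_commute algebra_simps)

lemma bilinear_deformed:
  assumes "bilinear_map scale m"
  shows "bilinear_map scale (deformed t m)"
  by (rule bilinear_mapI)
    (simp_all add: deformed_def bilinear_mapD[OF assms] bilinear_mapD[OF bilinear_induced[OF assms]]
      scale_left_commute algebra_simps)

lemma linear_id_plus_scale_N: "Vector_Spaces.linear scale scale (\<lambda>a. a + scale t (N a))"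
  by (auto intro!: Vector_Spaces.linear.intro module_hom.intro module_hom_axioms.intro
      vector_space_axioms module_axioms simp: N_add N_scale scale_left_commute algebra_simps)

lemma deformed_multiplicative:
  assumes "bilinear_map scale m" "nijenhuis m"
  shows "deformed t m a b + scale t (N (deformed t m a b))
    = m (a + scale t (N a)) (b + scale t (N b))"
proof -
  have lin: "induced m a b + N (m a b) = m a (N b) + m (N a) b"
    by (simp add: induced_def)
  have quad: "N (induced m a b) = m (N a) (N b)"
    using assms(2) by (simp add: nijenhuis_def)
  have "deformed t m a b + scale t (N (deformed t m a b))
      = m a b + scale t (induced m a b + N (m a b)) + scale t (scale t (N (induced m a b)))"
    by (simp add: deformed_def N_add N_scale algebra_simps)
  also have "\<dots> = m (a + scale t (N a)) (b + scale t (N b))"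
    unfolding lin quad by (simp add: bilinear_mapD[OF assms(1)] algebra_simps)
  finally show ?thesis .
qed

text \<open>
  The linear and quadratic coefficients in \<open>t\<close> of a deformed double product, as operators on
  trilinear maps. They are those of the transported map
  \<open>(id + t N)\<inverse> (f ((id + t N) a) ((id + t N) b) ((id + t N) c))\<close>, expanded at \<open>t = 0\<close>.
\<close>

definition first_order :: "('a \<Rightarrow> 'a \<Rightarrow> 'a \<Rightarrow> 'a) \<Rightarrow> 'a \<Rightarrow> 'a \<Rightarrow> 'a \<Rightarrow> 'a" where
  "first_order f a b c = f (N a) b c + f a (N b) c + f a b (N c) - N (f a b c)"

definition second_order :: "('a \<Rightarrow> 'a \<Rightarrow> 'a \<Rightarrow> 'a) \<Rightarrow> 'a \<Rightarrow> 'a \<Rightarrow> 'a \<Rightarrow> 'a" where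
  "second_order f a b c =
     f (N a) (N b) c + f (N a) b (N c) + f a (N b) (N c) - N (first_order f a b c)"

definition deformed_ternary ::
    "'k \<Rightarrow> ('a \<Rightarrow> 'a \<Rightarrow> 'a \<Rightarrow> 'a) \<Rightarrow> 'a \<Rightarrow> 'a \<Rightarrow> 'a \<Rightarrow> 'a" where
  "deformed_ternary t f a b c =
     f a b c + scale t (first_order f a b c) + scale t (scale t (second_order f a b c))"

lemma deformed_ternary_add:
  "deformed_ternary t (\<lambda>a b c. f a b c + g a b c) a b c
    = deformed_ternary t f a b c + deformed_ternary t g a b c"
proof -
  have "first_order (\<lambda>a b c. f a b c + g a b c) a b c = first_order f a b c + first_order g a b c"
    by (simp add: first_order_def N_add)
  moreover from this
  have "second_order (\<lambda>a b c. f a b c + g a b c) a b c = second_order f a b c + second_order g a b c"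
    by (simp add: second_order_def N_add)
  ultimately show ?thesis
    by (simp add: deformed_ternary_def scale_right_distrib)
qed

text \<open>
  The linear term follows from bilinearity, as the two terms \<open>m' (N (m a b)) c\<close> cancel. In the
  quadratic term, the Nijenhuis condition for \<open>m\<close> turns \<open>N\<close> of the inner induced product into
  \<open>m (N a) (N b)\<close>, and the remaining \<open>m' (N (m a b)) (N c)\<close> is pulled under \<open>N\<close> by the Nijenhuis
  condition for \<open>m'\<close>, where it completes \<open>N\<close> of the linear term.
\<close>

lemma deformed_left_product:
  assumes m: "bilinear_map scale m" "nijenhuis m"
    and m': "bilinear_map scale m'" "nijenhuis m'"
  shows "deformed t m' (deformed t m a b) c = deformed_ternary t (\<lambda>a b c. m' (m a b) c) a b c"
proof -
  note bil = bilinear_mapD[OF m'(1)]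
  note bil_ind = bilinear_mapD[OF bilinear_induced[OF m'(1)]]
  let ?f = "\<lambda>a b c. m' (m a b) c"
  have lin: "induced m' (m a b) c + m' (induced m a b) c = first_order ?f a b c"
    by (simp add: induced_def first_order_def bil algebra_simps)
  have "induced m' (induced m a b) c
      = m' (induced m a b) (N c) + m' (m (N a) (N b)) c - N (m' (induced m a b) c)"
    using m(2) by (simp add: induced_def[of m'] nijenhuis_def)
  also have "m' (induced m a b) (N c)
      = ?f a (N b) (N c) + ?f (N a) b (N c) - N (induced m' (m a b) c)"
    using m'(2) by (simp add: induced_def[of m] bil nijenhuis_def)
  finally have quad: "induced m' (induced m a b) c = second_order ?f a b c"
    unfolding second_order_def lin[symmetric] by (simp add: N_add algebra_simps)
  have "deformed t m' (deformed t m a b) c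
      = ?f a b c + scale t (induced m' (m a b) c + m' (induced m a b) c)
        + scale t (scale t (induced m' (induced m a b) c))"
    by (simp add: deformed_def bil bil_ind algebra_simps)
  then show ?thesis
    by (simp add: deformed_ternary_def lin quad)
qed

lemma bilinear_opposite: "bilinear_map scale (\<lambda>a b. m b a) = bilinear_map scale m"
  by (auto simp: bilinear_map_def)

lemma induced_opposite: "induced (\<lambda>a b. m b a) a b = induced m b a"
  by (simp add: induced_def add.commute)

lemma nijenhuis_opposite: "nijenhuis (\<lambda>a b. m b a) = nijenhuis m"
  by (auto simp: nijenhuis_def induced_opposite[of m])

text \<open>
  Passing to opposite products exchanges the two bracketings and reverses the arguments, and the
  coefficient operators are symmetric under this reversal. The rules for opposite products are
  instantiated in the proof because their left-hand sides match every product and would rewrite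
  forever.
\<close>

lemma deformed_right_product:
  assumes "bilinear_map scale m" "nijenhuis m" "bilinear_map scale m'" "nijenhuis m'"
  shows "deformed t m' a (deformed t m b c) = deformed_ternary t (\<lambda>a b c. m' a (m b c)) a b c"
proof -
  have "deformed t (\<lambda>a b. m' b a) (deformed t (\<lambda>a b. m b a) c b) a
      = deformed_ternary t (\<lambda>c b a. m' a (m b c)) c b a"
    using assms
    by (intro deformed_left_product)
      (simp_all only: bilinear_opposite[of m] bilinear_opposite[of m']
        nijenhuis_opposite[of m] nijenhuis_opposite[of m'])
  also have "\<dots> = deformed_ternary t (\<lambda>a b c. m' a (m b c)) a b c"
    by (simp add: deformed_ternary_def first_order_def second_order_def algebra_simps)
  finally show ?thesis
    by (simp only: deformed_def induced_opposite[of m] induced_opposite[of m'])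
qed

lemma deformed_associative:
  assumes "bilinear_map scale m" "nijenhuis m"
    and "\<And>a b c. m (m a b) c = m a (m b c)"
  shows "deformed t m (deformed t m a b) c = deformed t m a (deformed t m b c)"
  using assms by (simp add: deformed_left_product deformed_right_product)

lemma deformed_compatible:
  assumes "bilinear_map scale m" "nijenhuis m" "bilinear_map scale m'" "nijenhuis m'"
    and "\<And>a b c. m' (m a b) c + m (m' a b) c = m a (m' b c) + m' a (m b c)"
  shows "deformed t m' (deformed t m a b) c + deformed t m (deformed t m' a b) c
    = deformed t m a (deformed t m' b c) + deformed t m' a (deformed t m b c)"
  using assms
  by (simp add: deformed_left_product deformed_right_product flip: deformed_ternary_add)

end

theorem proposition4p3:
  fixes scale :: "'k::field_char_0 \<Rightarrow> 'a::ab_group_add \<Rightarrow> 'a"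
    and mu1 mu2 w1 w2 :: "'a \<Rightarrow> 'a \<Rightarrow> 'a"
    and N :: "'a \<Rightarrow> 'a"
  assumes "compatible_associative_algebra scale mu1 mu2"
    and "compatible_associative_algebra.nijenhuis_operator scale mu1 mu2 N"
    and "\<And>a b. w1 a b = mu1 a (N b) + mu1 (N a) b - N (mu1 a b)"
    and "\<And>a b. w2 a b = mu2 a (N b) + mu2 (N a) b - N (mu2 a b)"
  shows "compatible_associative_algebra.generates_linear_deformation scale mu1 mu2 w1 w2 \<and>
    compatible_associative_algebra.trivial_linear_deformation scale mu1 mu2 w1 w2"
proof -
  interpret A: compatible_associative_algebra scale mu1 mu2 by (rule assms(1))
  interpret E: linear_endomorphism scale N
    using assms(2)
    by (intro linear_endomorphism.intro linear_endomorphism_axioms.intro A.vector_space_axioms)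
      (simp add: A.nijenhuis_operator_def)
  have w: "w1 = E.induced mu1" "w2 = E.induced mu2"
    by (auto simp: fun_eq_iff assms(3,4) E.induced_def)
  have nij: "E.nijenhuis mu1" "E.nijenhuis mu2"
    using assms(2) by (auto simp: A.nijenhuis_operator_def E.nijenhuis_def E.induced_def)
  have def1: "A.deform t mu1 w1 = E.deformed t mu1"
    and def2: "A.deform t mu2 w2 = E.deformed t mu2" for t
    by (auto simp: fun_eq_iff A.deform_def E.deformed_def w)
  have undeformed: "A.deform t m (\<lambda>a b. 0) = m" for t m
    by (simp add: A.deform_def)
  have alg: "compatible_associative_algebra scale (E.deformed t mu1) (E.deformed t mu2)" for t
    by unfold_locales
      (intro A.finite_dimensional E.bilinear_deformed E.deformed_associative E.deformed_compatible
        A.bilinear1 A.bilinear2 A.assoc1 A.assoc2 A.compatible nij)+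
  have gen: "A.generates_linear_deformation w1 w2"
    using alg
    by (simp add: A.generates_linear_deformation_def def1 def2 w[symmetric])
      (simp add: w E.bilinear_induced A.bilinear1 A.bilinear2)
  have zero: "A.generates_linear_deformation (\<lambda>a b. 0) (\<lambda>a b. 0)"
    by (simp add: A.generates_linear_deformation_def undeformed assms(1) A.bilinear_mapI)
  have "compatible_associative_algebra_morphism
      scale (E.deformed t mu1) (E.deformed t mu2) scale mu1 mu2 (\<lambda>a. a + scale t (N a))" for t
    by (intro compatible_associative_algebra_morphism.intro
        compatible_associative_algebra_morphism_axioms.intro alg assms(1)
        E.linear_id_plus_scale_N E.deformed_multiplicative A.bilinear1 A.bilinear2 nij)
  then have "A.trivial_linear_deformation w1 w2"
    unfolding A.trivial_linear_deformation_def A.equivalent_linear_deformations_def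
    using gen zero E.linear_N by (auto simp: def1 def2 undeformed)
  with gen show ?thesis ..
qed

end
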